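(* For every $(\alpha,h)\in\mathcal{U}^{rs}$, $$\frac{2S_n}{n^2}\longrightarrow u^*(\alpha,h)\quad\text{almost surely with respect to } \bar{\mathbb{P}}_{\alpha,h},\ \text{ as } n\to+\infty,$$ where $u^*(\alpha,h)$ is the unique maximizer of $u\mapsto \frac{\alpha}{6}u^3+\frac h2 u-\frac12 I(u)$ on $[0,1]$.
   Context: Mean-field model. For $n\in\mathbb{N}$ let $\mathcal{E}_n$ be the edge set of the complete graph on $n$ labeled vertices (so $|\mathcal{E}_n|=\binom n2$) and $\mathcal{A}_n=\{0,1\}^{\mathcal{E}_n}$. For $\alpha,h\in\mathbb{R}$ and $x\in\mathcal{A}_n$ set $\bar{\mathcal{H}}_{n;\alpha,h}(x)=\frac{4\alpha}{3n^4}\left(\sum_{i\in\mathcal{E}_n}x_i\right)^3+h\sum_{i\in\mathcal{E}_n}x_i$. Let $\bar{\mathbb{P}}_{n;\alpha,h}$ be the probability measure on $\mathcal{A}_n$ with density $e^{\bar{\mathcal{H}}_{n;\alpha,h}(x)}/\bar Z_{n;\alpha,h}$, $\bar Z_{n;\alpha,h}=\sum_{x\in\mathcal{A}_n}e^{\bar{\mathcal{H}}_{n;\alpha,h}(x)}$, and let $S_n(x)=\sum_{i\in\mathcal{E}_n}x_i$. Let $I(u)=u\ln u+(1-u)\ln(1-u)$ on $[0,1]$ (with $0\ln 0=0$). For $\alpha>-2$ consider the scalar problem $\sup_{0\le u\le1}\left(\frac\alpha6u^3+\frac h2u-\frac12I(u)\right)$. It is known that it has a unique maximizer except when $(\alpha,h)$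 lies on a critical curve $\mathcal{M}^{rs}=\{(\alpha,h):\alpha>\alpha_c,\ h<h_c,\ h=q(\alpha)\}$ ($q$ a continuous, strictly decreasing function), on which there are exactly two maximizers; here $(\alpha_c,h_c)=\left(\frac{27}{8},\ln2-\frac32\right)$, which does not belong to $\mathcal{M}^{rs}$. Set $\mathcal{U}^{rs}=\left((-2,+\infty)\times\mathbb{R}\right)\setminus\mathcal{M}^{rs}$. $\bar{\mathbb{P}}_{\alpha,h}$ denotes any probability measure on a space on which all the $S_n$, $n\ge1$, are jointly defined and such that for each $n$ the law of $S_n$ is its law under $\bar{\mathbb{P}}_{n;\alpha,h}$. *)

theory Defs
  imports "HOL-Probability.Probability"
begin

text \<open>The mean-field model on the edges of the complete graph with vertex set \<open>{0..<n}\<close>.\<close>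

definition complete_edges :: "nat \<Rightarrow> nat set set" where
  "complete_edges n = {e. e \<subseteq> {..<n} \<and> card e = 2}"

definition configs :: "nat \<Rightarrow> (nat set \<Rightarrow> real) set" where
  "configs n = complete_edges n \<rightarrow>\<^sub>E {0, 1}"

definition edge_count :: "nat \<Rightarrow> (nat set \<Rightarrow> real) \<Rightarrow> real" where
  "edge_count n x = (\<Sum>i\<in>complete_edges n. x i)"

definition mf_hamiltonian :: "nat \<Rightarrow> real \<Rightarrow> real \<Rightarrow> (nat set \<Rightarrow> real) \<Rightarrow> real" where
  "mf_hamiltonian n \<alpha> h x =
     4 * \<alpha> / (3 * real n ^ 4) * (\<Sum>i\<in>complete_edges n. x i) ^ 3
     + h * (\<Sum>i\<in>complete_edges n. x i)"

definition mf_partition :: "nat \<Rightarrow> real \<Rightarrow> real \<Rightarrow> real" where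
  "mf_partition n \<alpha> h = (\<Sum>x\<in>configs n. exp (mf_hamiltonian n \<alpha> h x))"

definition mf_measure :: "nat \<Rightarrow> real \<Rightarrow> real \<Rightarrow> (nat set \<Rightarrow> real) measure" where
  "mf_measure n \<alpha> h =
     point_measure (configs n)
       (\<lambda>x. ennreal (exp (mf_hamiltonian n \<alpha> h x) / mf_partition n \<alpha> h))"

text \<open>In the entropy, the convention \<open>0 ln 0 = 0\<close> holds since multiplication by \<open>0\<close> gives \<open>0\<close>.\<close>

definition entropy_fun :: "real \<Rightarrow> real" where
  "entropy_fun u = u * ln u + (1 - u) * ln (1 - u)"

definition scalar_functional :: "real \<Rightarrow> real \<Rightarrow> real \<Rightarrow> real" where
  "scalar_functional \<alpha> h u = \<alpha> / 6 * u ^ 3 + h / 2 * u - 1 / 2 * entropy_fun u"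

definition maximizers :: "real \<Rightarrow> real \<Rightarrow> real set" where
  "maximizers \<alpha> h =
     {u \<in> {0..1}. \<forall>v\<in>{0..1}. scalar_functional \<alpha> h v \<le> scalar_functional \<alpha> h u}"

definition alpha_crit :: real where "alpha_crit = 27 / 8"

definition h_crit :: real where "h_crit = ln 2 - 3 / 2"

text \<open>For \<open>\<alpha> > alpha_crit\<close>, the value \<open>critical_curve \<alpha>\<close> is the only field \<open>h\<close> at which the
  scalar problem has two maximizers. For other \<open>\<alpha>\<close> there is no such \<open>h\<close> and the value is
  irrelevant.\<close>

definition critical_curve :: "real \<Rightarrow> real" where
  "critical_curve \<alpha> = (THE h. card (maximizers \<alpha> h) = 2)"

definition M_rs :: "(real \<times> real) set" where
  "M_rs = {(\<alpha>, h). \<alpha> > alpha_crit \<and> h < h_crit \<and> h = critical_curve \<alpha>}"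

definition U_rs :: "(real \<times> real) set" where
  "U_rs = ({-2<..} \<times> UNIV) - M_rs"

definition u_star :: "real \<Rightarrow> real \<Rightarrow> real" where
  "u_star \<alpha> h = (THE u. u \<in> maximizers \<alpha> h)"

end

theory Submission
  imports Defs "HOL-Real_Asymp.Real_Asymp"
begin

text \<open>The energy depends on a configuration only through its number of edges, and there are
  \<open>N = n choose 2\<close> possible edges. So the weight of the configurations with \<open>k\<close> edges is
  \<open>N choose k\<close> times the exponential of an energy. Since \<open>N choose k\<close> equals
  \<open>exp (- N * entropy_fun (k / N))\<close> up to a factor \<open>N + 1\<close> (\<open>choose_exp_entropy_bounds\<close>), this
  weight is \<open>exp (n\<^sup>2 * scalar_functional \<alpha> h (k / N) + O(n))\<close>. Comparing with the weight at a
  density close to a maximizer \<open>u\<close>, the densities at distance at least \<open>\<epsilon>\<close> from \<open>u\<close> have total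
  probability at most \<open>exp (- \<eta> * n\<^sup>2 + O(n))\<close> for some \<open>\<eta> > 0\<close>, provided that \<open>u\<close> is the only
  maximizer (\<open>edge_density_deviation_bound\<close>). These probabilities are summable, and the
  Borel--Cantelli lemma turns this into almost sure convergence, whatever the joint law of the
  edge counts is.

  It remains to see that the maximizer is unique off the critical curve
  (\<open>maximizers_eq_u_star\<close>). Maximizers are interior, hence stationary. The second derivative
  vanishes where \<open>2 \<alpha> p\<^sup>2 (1 - p) = 1\<close>, and \<open>p\<^sup>2 (1 - p)\<close> increases up to \<open>2/3\<close> and
  decreases afterwards. By Rolle's theorem two maximizers enclose two such points, so they lie
  strictly on either side of \<open>2/3\<close> and \<open>\<alpha>\<close> exceeds its critical value
  (\<open>two_maximizers_separated\<close>). In particular there are never three. Moving the field moves all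
  maximizers in the same direction, which leaves one field at most with two maximizers for a given
  \<open>\<alpha>\<close>; and comparison with the critical point, where \<open>2/3\<close> is a maximizer, shows that this field
  is below \<open>h_crit\<close>. So a pair \<open>(\<alpha>, h)\<close> with two maximizers lies on \<open>M_rs\<close>.\<close>

section \<open>Uniqueness of the maximizer off the critical curve\<close>

lemma continuous_on_x_ln_x: "continuous_on {0::real..1} (\<lambda>x. x * ln x)"
proof -
  have "((\<lambda>x::real. x * ln x) \<longlongrightarrow> 0) (at_right 0)"
    by real_asymp
  then have "((\<lambda>x::real. x * ln x) \<longlongrightarrow> 0) (at 0 within {0..1})"
    by (simp add: at_within_Icc_at_right)
  moreover have "continuous (at x within {0..1}) (\<lambda>x::real. x * ln x)"
    if "x \<in> {0..1}" "x \<noteq> 0" for x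
    using that by (intro continuous_intros) auto
  ultimately show ?thesis
    unfolding continuous_on_eq_continuous_within
    by (metis continuous_within mult_zero_left)
qed

lemma continuous_on_entropy_fun: "continuous_on {0..1} entropy_fun"
proof -
  have "continuous_on {0..1} (\<lambda>x::real. (1 - x) * ln (1 - x))"
    by (rule continuous_on_compose2[OF continuous_on_x_ln_x, where f = "\<lambda>x. 1 - x"])
       (auto intro!: continuous_intros)
  then have "continuous_on {0..1} (\<lambda>x::real. x * ln x + (1 - x) * ln (1 - x))"
    by (intro continuous_on_add continuous_on_x_ln_x)
  then show ?thesis
    by (simp add: entropy_fun_def [abs_def])
qed

lemma continuous_on_scalar_functional: "continuous_on {0..1} (scalar_functional \<alpha> h)"
  unfolding scalar_functional_def [abs_def]
  by (intro continuous_intros continuous_on_entropy_fun)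

lemma maximizers_nonempty: "maximizers \<alpha> h \<noteq> {}"
  using continuous_attains_sup[OF compact_Icc _ continuous_on_scalar_functional[of \<alpha> h]]
  by (auto simp: maximizers_def)

lemma maximizers_le:
  "u \<in> maximizers \<alpha> h \<Longrightarrow> v \<in> {0..1} \<Longrightarrow> scalar_functional \<alpha> h v \<le> scalar_functional \<alpha> h u"
  by (auto simp: maximizers_def)

lemma maximizersD: "u \<in> maximizers \<alpha> h \<Longrightarrow> 0 \<le> u \<and> u \<le> 1"
  by (auto simp: maximizers_def)

text \<open>The slope of \<open>- t ln t\<close> is infinite at \<open>0\<close> and beats the bounded slope of the
  polynomial part, so a step of length \<open>t\<close> away from either end point increases the
  functional as soon as \<open>- ln t > \<bar>\<alpha>\<bar> + \<bar>h\<bar>\<close>.\<close>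

lemma maximizers_interior:
  assumes "u \<in> maximizers \<alpha> h"
  shows "0 < u" "u < 1"
proof -
  define t where "t = exp (- (\<bar>\<alpha>\<bar> + \<bar>h\<bar>) - 1)"
  have t: "0 < t" "t < 1" and ln_t: "ln t = - (\<bar>\<alpha>\<bar> + \<bar>h\<bar>) - 1"
    by (auto simp: t_def)
  have gain: "entropy_fun t \<le> - t * (\<bar>\<alpha>\<bar> + \<bar>h\<bar> + 1)"
  proof -
    have "(1 - t) * ln (1 - t) \<le> 0"
      using t by (intro mult_nonneg_nonpos) auto
    then show ?thesis
      by (simp add: entropy_fun_def ln_t algebra_simps)
  qed
  have cube: "0 \<le> t ^ 3" "t ^ 3 \<le> t"
    using t power_decreasing[of 1 3 t] by auto
  have "\<bar>\<alpha> * t ^ 3\<bar> \<le> \<bar>\<alpha>\<bar> * t"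
    using cube by (simp add: abs_mult mult_left_mono)
  moreover have h: "\<bar>h * t\<bar> = \<bar>h\<bar> * t"
    using t by (simp add: abs_mult)
  moreover have "0 \<le> \<bar>\<alpha>\<bar> * t"
    using t by simp
  ultimately have "0 < scalar_functional \<alpha> h t"
    using gain t by (simp add: scalar_functional_def algebra_simps)
  then have "u \<noteq> 0"
    using maximizers_le[OF assms, of t] t by (auto simp: scalar_functional_def entropy_fun_def)
  then show "0 < u"
    using maximizersD[OF assms] by simp
  have "1 - (1 - t) ^ 3 = t * (3 - 3 * t + t ^ 2)"
    by (simp add: algebra_simps power2_eq_square power3_eq_cube)
  moreover have "t ^ 2 \<le> t"
    using t power_decreasing[of 1 2 t] by auto
  moreover have "0 \<le> t ^ 2"
    by simp
  ultimately have "0 \<le> 1 - (1 - t) ^ 3" "1 - (1 - t) ^ 3 \<le> 3 * t"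
    using t by (auto intro!: mult_nonneg_nonneg)
  then have "\<bar>\<alpha> * (1 - (1 - t) ^ 3)\<bar> \<le> \<bar>\<alpha>\<bar> * (3 * t)"
    unfolding abs_mult by (intro mult_left_mono) auto
  then have "\<alpha> * (1 - (1 - t) ^ 3) \<le> \<bar>\<alpha>\<bar> * (3 * t)"
    by linarith
  moreover have "h * t \<le> \<bar>h\<bar> * t"
    using h by linarith
  moreover have "entropy_fun (1 - t) = entropy_fun t"
    by (simp add: entropy_fun_def)
  moreover have "scalar_functional \<alpha> h (1 - t) - scalar_functional \<alpha> h 1
      = - (\<alpha> * (1 - (1 - t) ^ 3)) / 6 - (h * t) / 2 - entropy_fun (1 - t) / 2"
    by (simp add: scalar_functional_def entropy_fun_def[of 1] field_simps)
  moreover have "entropy_fun t \<le> - (\<bar>\<alpha>\<bar> * t) - \<bar>h\<bar> * t - t"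
    using gain by (simp add: algebra_simps)
  ultimately have "scalar_functional \<alpha> h 1 < scalar_functional \<alpha> h (1 - t)"
    using t by linarith
  then have "u \<noteq> 1"
    using maximizers_le[OF assms, of "1 - t"] t by auto
  then show "u < 1"
    using maximizersD[OF assms] by simp
qed

lemma scalar_functional_has_derivative:
  assumes "0 < u" "u < 1"
  shows "(scalar_functional \<alpha> h has_real_derivative
           (\<alpha> * u ^ 2 + h - ln u + ln (1 - u)) / 2) (at u)"
proof -
  have "(entropy_fun has_real_derivative
      (ln u + u * (1 / u)) + (- ln (1 - u) + (1 - u) * (- 1 / (1 - u)))) (at u)"
    unfolding entropy_fun_def [abs_def]
    using assms by (auto intro!: derivative_eq_intros)
  then have "(entropy_fun has_real_derivative ln u - ln (1 - u)) (at u)"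
    using assms by simp
  then show ?thesis
    unfolding scalar_functional_def [abs_def]
    by (auto intro!: derivative_eq_intros simp: algebra_simps add_divide_distrib diff_divide_distrib)
qed

lemma maximizers_stationary:
  assumes "u \<in> maximizers \<alpha> h"
  shows "\<alpha> * u ^ 2 + h - ln u + ln (1 - u) = 0"
proof -
  note u = maximizers_interior[OF assms]
  have "(\<alpha> * u ^ 2 + h - ln u + ln (1 - u)) / 2 = 0"
  proof (rule DERIV_local_max[OF scalar_functional_has_derivative[OF u]])
    show "0 < min u (1 - u)"
      using u by simp
    show "\<forall>y. \<bar>u - y\<bar> < min u (1 - u) \<longrightarrow> scalar_functional \<alpha> h y \<le> scalar_functional \<alpha> h u"
      using maximizers_le[OF assms] by (auto simp: abs_real_def split: if_splits)
  qed
  then show ?thesis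
    by simp
qed

lemma inflection_between_stationary:
  fixes u v \<alpha> h :: real
  assumes "0 < u" "u < v" "v < 1"
    and "\<alpha> * u ^ 2 + h - ln u + ln (1 - u) = 0" "\<alpha> * v ^ 2 + h - ln v + ln (1 - v) = 0"
  obtains p where "u < p" "p < v" "2 * \<alpha> * (p ^ 2 * (1 - p)) = 1"
proof -
  have "\<exists>p. u < p \<and> p < v \<and> 2 * \<alpha> * p - 1 / p - 1 / (1 - p) = 0"
  proof -
    have D: "((\<lambda>x. \<alpha> * x ^ 2 + h - ln x + ln (1 - x)) has_real_derivative
        2 * \<alpha> * p - 1 / p - 1 / (1 - p)) (at p)" if "u \<le> p" "p \<le> v" for p
      using that assms by (auto intro!: derivative_eq_intros simp: field_simps)
    from MVT2[OF \<open>u < v\<close> D] assms show ?thesis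
      by auto
  qed
  then obtain p where p: "u < p" "p < v" "2 * \<alpha> * p - 1 / p - 1 / (1 - p) = 0"
    by blast
  then have "2 * \<alpha> * (p ^ 2 * (1 - p)) = 1"
    using assms by (simp add: field_simps power2_eq_square)
  with p that show ?thesis
    by blast
qed

lemma stationary_between_maximizers:
  assumes "u \<in> maximizers \<alpha> h" "v \<in> maximizers \<alpha> h" "u < v"
  obtains w where "u < w" "w < v" "\<alpha> * w ^ 2 + h - ln w + ln (1 - w) = 0"
proof -
  note int = maximizers_interior[OF assms(1)] maximizers_interior[OF assms(2)]
  have "scalar_functional \<alpha> h u = scalar_functional \<alpha> h v"
    using assms by (auto intro!: antisym maximizers_le dest: maximizersD)
  moreover have "\<exists>z>u. z < v \<and> scalar_functional \<alpha> h v - scalar_functional \<alpha> h u =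
      (v - u) * ((\<alpha> * z ^ 2 + h - ln z + ln (1 - z)) / 2)"
    using int by (intro MVT2 \<open>u < v\<close> scalar_functional_has_derivative) auto
  ultimately show ?thesis
    using that \<open>u < v\<close> by auto
qed

text \<open>The cubic \<open>p\<^sup>2 (1 - p)\<close>, whose level sets contain the inflection points, has its maximum
  on \<open>[0, 1]\<close> at \<open>2/3\<close> and is strictly monotone on either side of it. The differences factor
  through the polynomials below.\<close>

lemma cubic_less_max:
  assumes "0 \<le> p" "p \<noteq> 2 / 3"
  shows "p ^ 2 * (1 - p) < (4::real) / 27"
proof -
  have "4 / 27 - p ^ 2 * (1 - p) = (p - 2 / 3) ^ 2 * (p + 1 / 3)"
    by (simp add: field_simps power2_eq_square)
  also have "\<dots> > 0"
    using assms by simp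
  finally show ?thesis
    by simp
qed

lemma cubic_level_set_separated:
  fixes p q :: real
  assumes "0 < p" "p < q" "p ^ 2 * (1 - p) = q ^ 2 * (1 - q)"
  shows "p < 2 / 3" "2 / 3 < q"
proof -
  have "(q - p) * (p + q - p ^ 2 - p * q - q ^ 2) = q ^ 2 * (1 - q) - p ^ 2 * (1 - p)"
    by (simp add: algebra_simps power2_eq_square)
  with assms have *: "p + q = p ^ 2 + p * q + q ^ 2"
    by simp
  show "p < 2 / 3"
  proof (rule ccontr)
    assume "\<not> p < 2 / 3"
    then have "p * (2 / 3) \<le> p * p" "p * (2 / 3) \<le> p * q" "q * (2 / 3) < q * q" "(2 / 3) * q \<le> p * q"
      using assms by (auto intro!: mult_left_mono mult_right_mono mult_strict_left_mono)
    with * show False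
      unfolding power2_eq_square by linarith
  qed
  show "2 / 3 < q"
  proof (rule ccontr)
    assume "\<not> 2 / 3 < q"
    then have "p * p < p * (2 / 3)" "p * q \<le> p * (2 / 3)" "q * q \<le> q * (2 / 3)" "p * q < (2 / 3) * q"
      using assms by (auto intro!: mult_left_mono mult_strict_left_mono mult_strict_right_mono)
    with * show False
      unfolding power2_eq_square by linarith
  qed
qed

text \<open>Two maximizers enclose a third stationary point, hence two distinct inflection points
  \<open>p < q\<close> between them. These lie on one level set of the cubic, so \<open>p < 2/3 < q\<close>, and the level
  \<open>1 / (2 \<alpha>)\<close> is below the maximum \<open>4/27\<close> of the cubic.\<close>

lemma two_maximizers_separated:
  assumes "u \<in> maximizers \<alpha> h" "v \<in> maximizers \<alpha> h" "u < v"
  shows "u < 2 / 3" "2 / 3 < v" "alpha_crit < \<alpha>"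
proof -
  note int = maximizers_interior[OF assms(1)] maximizers_interior[OF assms(2)]
  obtain w where w: "u < w" "w < v" "\<alpha> * w ^ 2 + h - ln w + ln (1 - w) = 0"
    using stationary_between_maximizers[OF assms] .
  obtain p where p: "u < p" "p < w" "2 * \<alpha> * (p ^ 2 * (1 - p)) = 1"
    using inflection_between_stationary[of u w \<alpha> h] int w maximizers_stationary[OF assms(1)]
    by auto
  obtain q where q: "w < q" "q < v" "2 * \<alpha> * (q ^ 2 * (1 - q)) = 1"
    using inflection_between_stationary[of w v \<alpha> h] int w maximizers_stationary[OF assms(2)]
    by auto
  have "\<alpha> \<noteq> 0"
    using p by auto
  then have level: "p ^ 2 * (1 - p) = q ^ 2 * (1 - q)"
    using p(3) q(3) by (metis mult_cancel_left mult_eq_0_iff zero_neq_numeral)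
  have pq: "0 < p" "p < q" "p < 1"
    using int p q w by auto
  note sep = cubic_level_set_separated[OF pq(1,2) level]
  show "u < 2 / 3" "2 / 3 < v"
    using sep p q by auto
  have c: "0 < p ^ 2 * (1 - p)" "p ^ 2 * (1 - p) < 4 / 27"
    using pq sep cubic_less_max[of p] by auto
  have "0 < \<alpha>"
    using p(3) c by (metis mult.commute zero_less_mult_pos zero_less_numeral zero_less_one)
  then have "2 * \<alpha> * (p ^ 2 * (1 - p)) < 2 * \<alpha> * (4 / 27)"
    using c by (intro mult_strict_left_mono) auto
  then show "alpha_crit < \<alpha>"
    using p(3) by (simp add: alpha_crit_def)
qed

lemma card_maximizers_eq_2:
  assumes "u \<in> maximizers \<alpha> h" "v \<in> maximizers \<alpha> h" "u \<noteq> v"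
  shows "card (maximizers \<alpha> h) = 2"
proof -
  have *: "card (maximizers \<alpha> h) = 2"
    if uv: "u \<in> maximizers \<alpha> h" "v \<in> maximizers \<alpha> h" "u < v" for u v
  proof -
    note sep = two_maximizers_separated[OF uv]
    have "w = u \<or> w = v" if w: "w \<in> maximizers \<alpha> h" for w
      using two_maximizers_separated(1,2)[OF w uv(1)] two_maximizers_separated(1,2)[OF uv(1) w]
        two_maximizers_separated(1,2)[OF w uv(2)] two_maximizers_separated(1,2)[OF uv(2) w] sep
      by linarith
    then have "maximizers \<alpha> h = {u, v}"
      using uv by auto
    then show ?thesis
      using \<open>u < v\<close> by simp
  qed
  show ?thesis
    using *[of u v] *[of v u] assms by linarith
qed

text \<open>At the critical point the cubic never exceeds the level \<open>4/27\<close>, which it takes only at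
  the stationary point \<open>2/3\<close>; a maximizer elsewhere would force an inflection point between the
  two.\<close>

lemma maximizer_at_critical_point: "2 / 3 \<in> maximizers alpha_crit h_crit"
proof -
  obtain w where w: "w \<in> maximizers alpha_crit h_crit"
    using maximizers_nonempty by blast
  note int = maximizers_interior[OF w]
  have st: "alpha_crit * (2 / 3) ^ 2 + h_crit - ln (2 / 3) + ln (1 - 2 / 3) = 0"
    by (simp add: alpha_crit_def h_crit_def power2_eq_square ln_div)
  have no: "p = 2 / 3" if "0 < p" "2 * alpha_crit * (p ^ 2 * (1 - p)) = 1" for p
    using that cubic_less_max[of p] by (auto simp: alpha_crit_def)
  have "w = 2 / 3"
  proof (cases w "2 / 3 :: real" rule: linorder_cases)
    case less
    then obtain p where "w < p" "p < 2 / 3" "2 * alpha_crit * (p ^ 2 * (1 - p)) = 1"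
      using inflection_between_stationary[of w "2 / 3" alpha_crit h_crit] int st
        maximizers_stationary[OF w] by auto
    with no[of p] int show ?thesis
      by auto
  next
    case greater
    then obtain p where "2 / 3 < p" "p < w" "2 * alpha_crit * (p ^ 2 * (1 - p)) = 1"
      using inflection_between_stationary[of "2 / 3" w alpha_crit h_crit] int st
        maximizers_stationary[OF w] by auto
    with no[of p] show ?thesis
      by auto
  qed
  with w show ?thesis
    by simp
qed

text \<open>For \<open>\<alpha> > alpha_crit\<close> and \<open>h \<ge> h_crit\<close> the functional is the one at the critical point plus
  an increasing function, so no maximizer lies to the left of \<open>2/3\<close>.\<close>

lemma two_maximizers_below_h_crit:
  assumes "u \<in> maximizers \<alpha> h" "v \<in> maximizers \<alpha> h" "u < v"
  shows "h < h_crit"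
proof (rule ccontr)
  assume "\<not> h < h_crit"
  note sep = two_maximizers_separated[OF assms]
  note u = maximizersD[OF assms(1)]
  have "scalar_functional alpha_crit h_crit u \<le> scalar_functional alpha_crit h_crit (2 / 3)"
    using u by (intro maximizers_le maximizer_at_critical_point) auto
  moreover have "scalar_functional \<alpha> h (2 / 3) \<le> scalar_functional \<alpha> h u"
    by (rule maximizers_le[OF assms(1)]) simp
  moreover have diff: "scalar_functional \<alpha> h x = scalar_functional alpha_crit h_crit x
      + (\<alpha> - alpha_crit) / 6 * x ^ 3 + (h - h_crit) / 2 * x" for x
    by (simp add: scalar_functional_def algebra_simps diff_divide_distrib)
  moreover have "(\<alpha> - alpha_crit) / 6 * u ^ 3 < (\<alpha> - alpha_crit) / 6 * (2 / 3) ^ 3"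
    using sep u by (intro mult_strict_left_mono power_strict_mono) auto
  moreover have "(h - h_crit) / 2 * u \<le> (h - h_crit) / 2 * (2 / 3)"
    using sep u \<open>\<not> h < h_crit\<close> by (intro mult_left_mono) auto
  ultimately show False
    using diff[of u] diff[of "2 / 3"] by linarith
qed

text \<open>Raising the field moves every maximizer to the right.\<close>

lemma maximizers_mono_field:
  assumes "u \<in> maximizers \<alpha> h" "v \<in> maximizers \<alpha> k" "h < k"
  shows "u \<le> v"
proof -
  have "scalar_functional \<alpha> h v \<le> scalar_functional \<alpha> h u"
       "scalar_functional \<alpha> k u \<le> scalar_functional \<alpha> k v"
    using assms by (auto intro!: maximizers_le dest: maximizersD)
  then have "0 \<le> (k - h) * (v - u)"
    by (simp add: scalar_functional_def algebra_simps)
  then show ?thesis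
    using assms(3) by (simp add: zero_le_mult_iff)
qed

text \<open>If \<open>h < k\<close> both had two maximizers, monotonicity would put the right one at \<open>h\<close>, which is
  beyond \<open>2/3\<close>, to the left of the left one at \<open>k\<close>, which is before \<open>2/3\<close>.\<close>

lemma two_maximizers_field_unique:
  assumes "u \<in> maximizers \<alpha> h" "v \<in> maximizers \<alpha> h" "u < v"
    and "u' \<in> maximizers \<alpha> k" "v' \<in> maximizers \<alpha> k" "u' < v'"
  shows "h = k"
  using maximizers_mono_field[OF assms(2,4)] maximizers_mono_field[OF assms(5,1)]
    two_maximizers_separated(1,2)[OF assms(1-3)] two_maximizers_separated(1,2)[OF assms(4-6)]
  by linarith

lemma two_maximizers_on_curve:
  assumes "u \<in> maximizers \<alpha> h" "v \<in> maximizers \<alpha> h" "u < v"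
  shows "(\<alpha>, h) \<in> M_rs"
proof -
  have "critical_curve \<alpha> = h"
    unfolding critical_curve_def
  proof (rule the_equality)
    show "card (maximizers \<alpha> h) = 2"
      using card_maximizers_eq_2 assms by auto
  next
    fix k
    assume "card (maximizers \<alpha> k) = 2"
    then obtain x y where xy: "x \<in> maximizers \<alpha> k" "y \<in> maximizers \<alpha> k" "x \<noteq> y"
      by (auto simp: card_2_iff)
    then show "k = h"
      using two_maximizers_field_unique[OF assms, of x k y]
        two_maximizers_field_unique[OF assms, of y k x] by linarith
  qed
  then show ?thesis
    using two_maximizers_separated(3)[OF assms] two_maximizers_below_h_crit[OF assms]
    by (simp add: M_rs_def)
qed

lemma maximizers_eq_u_star:
  assumes "(\<alpha>, h) \<in> U_rs"
  shows "maximizers \<alpha> h = {u_star \<alpha> h}"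
proof -
  obtain u where u: "u \<in> maximizers \<alpha> h"
    using maximizers_nonempty by blast
  have "v = u" if v: "v \<in> maximizers \<alpha> h" for v
    using two_maximizers_on_curve[OF u v] two_maximizers_on_curve[OF v u] assms
    by (cases u v rule: linorder_cases) (auto simp: U_rs_def)
  with u have "maximizers \<alpha> h = {u}"
    by blast
  then show ?thesis
    by (simp add: u_star_def)
qed

section \<open>Binomial coefficients and entropy\<close>

lemma entropy_fun_bounds:
  assumes "0 \<le> u" "u \<le> 1"
  shows "- 1 \<le> entropy_fun u" "entropy_fun u \<le> 0"
proof -
  have low: "x - 1 \<le> x * ln x" if "0 \<le> x" for x :: real
  proof (cases "x = 0")
    case False
    with that have "x * (1 - 1 / x) \<le> x * ln x"
      using ln_le_minus_one[of "1 / x"] by (intro mult_left_mono) (auto simp: ln_div)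
    with False show ?thesis
      by (simp add: right_diff_distrib)
  qed simp
  show "- 1 \<le> entropy_fun u"
    using low[of u] low[of "1 - u"] assms by (simp add: entropy_fun_def)
  have "u * ln u \<le> 0" "(1 - u) * ln (1 - u) \<le> 0"
    using assms by (cases "u = 0"; cases "u = 1"; simp add: mult_nonneg_nonpos)+
  then show "entropy_fun u \<le> 0"
    by (simp add: entropy_fun_def)
qed

lemma exp_entropy_fun:
  assumes "k \<le> N" "0 < N"
  shows "exp (real N * entropy_fun (real k / real N))
         = (real k / real N) ^ k * (1 - real k / real N) ^ (N - k)"
proof -
  have pow: "exp (real m * ln (real m / real N)) = (real m / real N) ^ m" for m
    using assms by (cases "m = 0") (auto simp: exp_of_nat_mult)
  have q: "1 - real k / real N = real (N - k) / real N"
    using assms by (simp add: of_nat_diff field_simps)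
  have "real N * entropy_fun (real k / real N)
      = real k * ln (real k / real N) + real (N - k) * ln (real (N - k) / real N)"
    unfolding entropy_fun_def q using assms by (simp add: distrib_left)
  then show ?thesis
    by (simp add: exp_add pow q)
qed

text \<open>The ratio of consecutive terms \<open>k\<^sup>j / j!\<close> is \<open>k / (j + 1)\<close>, which drops below \<open>1\<close>
  at \<open>j = k\<close>.\<close>

lemma power_over_fact_le:
  "real k ^ j / fact j \<le> real k ^ k / fact k"
proof (cases "j \<le> k")
  case True
  then show ?thesis
  proof (induction j rule: inc_induct)
    case (step j)
    have "real k ^ j / fact j = real k ^ Suc j / fact (Suc j) * (real (Suc j) / real k)"
      using step by (simp del: of_nat_Suc)
    also have "\<dots> \<le> real k ^ Suc j / fact (Suc j) * 1"
      using step by (intro mult_left_mono) auto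
    finally show ?case
      using step.IH by simp
  qed simp
next
  case False
  then have "k \<le> j"
    by simp
  then show ?thesis
  proof (induction j rule: dec_induct)
    case (step j)
    have "real k ^ Suc j / fact (Suc j) = real k ^ j / fact j * (real k / real (Suc j))"
      by (simp add: ac_simps del: of_nat_Suc)
    also have "\<dots> \<le> real k ^ j / fact j * 1"
      using step by (intro mult_left_mono) auto
    finally show ?case
      using step.IH by simp
  qed simp
qed

text \<open>For \<open>p = k / N\<close> the number below is the probability that a binomial variable with
  parameters \<open>N, p\<close> equals \<open>k\<close>. It is the largest of \<open>N + 1\<close> probabilities with sum \<open>1\<close>, because
  up to a constant the one at \<open>j\<close> is the product of \<open>k\<^sup>j / j!\<close> and
  \<open>(N - k)\<^bsup>N - j\<^esup> / (N - j)!\<close>, both of which are largest at \<open>j = k\<close>.\<close>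

lemma choose_exp_entropy_bounds:
  assumes "k \<le> N" "0 < N"
  shows "real (N choose k) * exp (real N * entropy_fun (real k / real N)) \<le> 1"
    and "1 \<le> (real N + 1) * (real (N choose k) * exp (real N * entropy_fun (real k / real N)))"
proof -
  define p where "p = real k / real N"
  define b where "b j = real (N choose j) * p ^ j * (1 - p) ^ (N - j)" for j
  have p: "0 \<le> p" "p \<le> 1" and q: "1 - p = real (N - k) / real N"
    using assms by (auto simp: p_def of_nat_diff field_simps)
  have bk: "b k = real (N choose k) * exp (real N * entropy_fun (real k / real N))"
    using exp_entropy_fun[OF assms] by (simp add: b_def p_def)
  have total: "(\<Sum>j\<le>N. b j) = 1"
    using binomial_ring[of p "1 - p" N] by (simp add: b_def)
  have nonneg: "0 \<le> b j" for j
    using p by (simp add: b_def)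
  have "b k \<le> (\<Sum>j\<le>N. b j)"
    using assms nonneg by (intro member_le_sum) auto
  then show "real (N choose k) * exp (real N * entropy_fun (real k / real N)) \<le> 1"
    using bk total by simp
  have mode: "b j \<le> b k" if "j \<le> N" for j
  proof -
    have split: "b i = fact N / real N ^ N * ((real k ^ i / fact i)
        * (real (N - k) ^ (N - i) / fact (N - i)))" if "i \<le> N" for i
    proof -
      have "real N ^ N = real N ^ i * real N ^ (N - i)"
        using that by (simp flip: power_add)
      then show ?thesis
        using binomial_fact[OF that, where 'a = real] q
        by (simp add: b_def p_def power_divide ac_simps)
    qed
    show ?thesis
      unfolding split[OF that] split[OF assms(1)]
      by (intro mult_left_mono mult_mono power_over_fact_le) auto
  qed
  have "1 \<le> (\<Sum>j\<le>N. b k)"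
    unfolding total[symmetric] by (intro sum_mono mode) simp
  then show "1 \<le> (real N + 1) * (real (N choose k) * exp (real N * entropy_fun (real k / real N)))"
    using bk by (simp add: add.commute)
qed

section \<open>The law of the number of edges\<close>

lemma finite_complete_edges: "finite (complete_edges n)"
  by (rule finite_subset[of _ "Pow {..<n}"]) (auto simp: complete_edges_def)

lemma card_complete_edges: "card (complete_edges n) = n choose 2"
  using n_subsets[of "{..<n}" 2] by (simp add: complete_edges_def)

lemma sum_over_zero_one_functions:
  fixes g :: "real \<Rightarrow> real"
  assumes "finite E"
  shows "(\<Sum>x\<in>E \<rightarrow>\<^sub>E {0, 1}. g (\<Sum>i\<in>E. x i))
       = (\<Sum>k\<le>card E. real (card E choose k) * g (real k))"
proof -
  have "(\<Sum>x\<in>E \<rightarrow>\<^sub>E {0, 1}. g (\<Sum>i\<in>E. x i)) = (\<Sum>T\<in>Pow E. g (real (card T)))"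
  proof (rule sum.reindex_bij_witness
      [where i = "\<lambda>T. restrict (\<lambda>i. if i \<in> T then 1 else 0) E" and j = "\<lambda>x. {i \<in> E. x i = 1}"])
    fix x :: "'a \<Rightarrow> real"
    assume x: "x \<in> E \<rightarrow>\<^sub>E {0, 1}"
    show "restrict (\<lambda>i. if i \<in> {i \<in> E. x i = 1} then 1 else 0) E = x"
      using x by (auto simp: PiE_def Pi_def extensional_def restrict_def fun_eq_iff)
    show "{i \<in> E. x i = 1} \<in> Pow E"
      by auto
    have "(\<Sum>i\<in>E. x i) = (\<Sum>i\<in>E. if x i = 1 then 1 else 0)"
      using x by (intro sum.cong) (auto simp: PiE_def Pi_def)
    also have "\<dots> = real (card {i \<in> E. x i = 1})"
      using assms by (simp add: sum.If_cases Int_def)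
    finally show "g (real (card {i \<in> E. x i = 1})) = g (\<Sum>i\<in>E. x i)"
      by simp
  next
    fix T
    assume T: "T \<in> Pow E"
    show "{i \<in> E. restrict (\<lambda>i. if i \<in> T then 1 else 0 :: real) E i = 1} = T"
      using T by auto
    show "restrict (\<lambda>i. if i \<in> T then 1 else 0 :: real) E \<in> E \<rightarrow>\<^sub>E {0, 1}"
      by auto
  qed
  also have "\<dots> = (\<Sum>k\<le>card E. \<Sum>T | T \<in> Pow E \<and> card T = k. g (real (card T)))"
    using assms by (intro sum.group[symmetric]) (auto simp: card_mono)
  also have "\<dots> = (\<Sum>k\<le>card E. real (card E choose k) * g (real k))"
    using n_subsets[OF assms] by (intro sum.cong refl) simp
  finally show ?thesis .
qed

lemma finite_configs: "finite (configs n)"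
  unfolding configs_def by (intro finite_PiE finite_complete_edges) auto

text \<open>The Hamiltonian of a configuration with \<open>y\<close> edges.\<close>

definition edge_energy :: "nat \<Rightarrow> real \<Rightarrow> real \<Rightarrow> real \<Rightarrow> real" where
  "edge_energy n \<alpha> h y = 4 * \<alpha> / (3 * real n ^ 4) * y ^ 3 + h * y"

lemma mf_hamiltonian_eq_edge_energy:
  "mf_hamiltonian n \<alpha> h x = edge_energy n \<alpha> h (edge_count n x)"
  by (simp add: mf_hamiltonian_def edge_energy_def edge_count_def)

lemma sum_configs:
  fixes g :: "real \<Rightarrow> real"
  shows "(\<Sum>x\<in>configs n. g (edge_count n x))
       = (\<Sum>k\<le>n choose 2. real ((n choose 2) choose k) * g (real k))"
  using sum_over_zero_one_functions[OF finite_complete_edges, of g n]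
  by (simp add: configs_def edge_count_def card_complete_edges)

lemma mf_partition_eq:
  "mf_partition n \<alpha> h
     = (\<Sum>k\<le>n choose 2. real ((n choose 2) choose k) * exp (edge_energy n \<alpha> h (real k)))"
  using sum_configs[of "\<lambda>y. exp (edge_energy n \<alpha> h y)" n]
  by (simp add: mf_partition_def mf_hamiltonian_eq_edge_energy)

lemma mf_partition_ge_term:
  assumes "k \<le> n choose 2"
  shows "real ((n choose 2) choose k) * exp (edge_energy n \<alpha> h (real k)) \<le> mf_partition n \<alpha> h"
  unfolding mf_partition_eq using assms by (intro member_le_sum) auto

lemma mf_partition_pos: "0 < mf_partition n \<alpha> h"
  by (rule less_le_trans[OF _ mf_partition_ge_term[of 0]]) auto

lemma measure_edge_count:
  assumes "B \<in> sets borel"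
  shows "measure (distr (mf_measure n \<alpha> h) borel (edge_count n)) B
       = (\<Sum>k\<in>{k. k \<le> n choose 2 \<and> real k \<in> B}.
            real ((n choose 2) choose k) * exp (edge_energy n \<alpha> h (real k)) / mf_partition n \<alpha> h)"
    (is "_ = ?rhs")
proof -
  let ?w = "\<lambda>y. exp (edge_energy n \<alpha> h y) / mf_partition n \<alpha> h"
  have meas: "edge_count n \<in> measurable (mf_measure n \<alpha> h) borel"
    by (simp add: mf_measure_def)
  have "measure (distr (mf_measure n \<alpha> h) borel (edge_count n)) B
      = measure (mf_measure n \<alpha> h) (edge_count n -` B \<inter> configs n)"
    using measure_distr[OF meas] assms by (simp add: mf_measure_def space_point_measure)
  also have "\<dots> = (\<Sum>x\<in>edge_count n -` B \<inter> configs n. ?w (edge_count n x))"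
    unfolding mf_measure_def mf_hamiltonian_eq_edge_energy
    using finite_configs mf_partition_pos[of n \<alpha> h]
    by (simp add: measure_point_measure_finite_if less_imp_le)
  also have "\<dots> = (\<Sum>x\<in>configs n. if edge_count n x \<in> B then ?w (edge_count n x) else 0)"
    using finite_configs by (simp add: sum.If_cases vimage_def Int_commute Int_def)
  also have "\<dots> = (\<Sum>k\<le>n choose 2. real ((n choose 2) choose k) *
      (if real k \<in> B then ?w (real k) else 0))"
    by (rule sum_configs)
  also have "\<dots> = (\<Sum>k\<le>n choose 2. if real k \<in> B
      then real ((n choose 2) choose k) * exp (edge_energy n \<alpha> h (real k)) / mf_partition n \<alpha> h
      else 0)"
    by (intro sum.cong) auto
  also have "\<dots> = ?rhs"
    by (simp add: sum.If_cases Int_def atMost_def)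
  finally show ?thesis .
qed

section \<open>Concentration of the edge density\<close>

lemma real_choose_2: "real (n choose 2) = real n * (real n - 1) / 2"
  by (cases n) (auto simp: choose_two real_of_nat_div algebra_simps)

text \<open>At edge density \<open>t\<close> the sum of energy and entropy is \<open>n\<^sup>2\<close> times the scalar functional, up
  to replacing \<open>n (n - 1)\<close> by \<open>n\<^sup>2\<close>, that is, up to powers of \<open>1 - 1 / n\<close>.\<close>

lemma energy_entropy_approx:
  assumes "2 \<le> n" "k \<le> n choose 2"
  defines "t \<equiv> real k / real (n choose 2)"
  shows "\<bar>edge_energy n \<alpha> h (real k) - real (n choose 2) * entropy_fun t
           - real n ^ 2 * scalar_functional \<alpha> h t\<bar> \<le> (\<bar>\<alpha>\<bar> + \<bar>h\<bar> + 1) * real n"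
proof -
  define r where "r = 1 - 1 / real n"
  have n: "0 < real n"
    using assms by simp
  have N: "real (n choose 2) = real n ^ 2 * r / 2"
    using n by (simp add: real_choose_2 r_def field_simps power2_eq_square)
  have r: "0 < r" "r \<le> 1" "1 - r = 1 / real n"
    using assms by (auto simp: r_def)
  then have k: "real k = real n ^ 2 * r / 2 * t"
    using n by (simp add: t_def N)
  have t: "0 \<le> t" "t \<le> 1"
    using assms by (auto simp: t_def divide_le_eq_1)
  have energy: "edge_energy n \<alpha> h (real k) = real n ^ 2 * (\<alpha> / 6 * r ^ 3 * t ^ 3 + h / 2 * r * t)"
    using n by (simp add: edge_energy_def k field_simps power_mult_distrib flip: power_mult)
  have "edge_energy n \<alpha> h (real k) - real (n choose 2) * entropy_fun t
           - real n ^ 2 * scalar_functional \<alpha> h t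
      = real n ^ 2 * (- (\<alpha> / 6 * ((1 - r ^ 3) * t ^ 3)) - h / 2 * ((1 - r) * t)
          + (1 - r) / 2 * entropy_fun t)"
    unfolding energy N scalar_functional_def by (simp add: field_simps)
  moreover have "\<bar>- (\<alpha> / 6 * ((1 - r ^ 3) * t ^ 3)) - h / 2 * ((1 - r) * t)
          + (1 - r) / 2 * entropy_fun t\<bar> \<le> (1 - r) * (\<bar>\<alpha>\<bar> + \<bar>h\<bar> + 1)"
  proof -
    have combine: "\<bar>- a - b + c\<bar> \<le> d * (A + H + 1)"
      if "\<bar>a\<bar> \<le> A / 6 * (d * 3)" "\<bar>b\<bar> \<le> H / 2 * (d * 1)" "\<bar>c\<bar> \<le> d / 2 * 1"
        "0 \<le> d * A" "0 \<le> d * H" "0 \<le> d" for a b c d A H :: real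
    proof -
      have "d * (A + H + 1) = d * A + d * H + d"
        by (simp add: distrib_left)
      moreover have "A / 6 * (d * 3) = (d * A) / 2" "H / 2 * (d * 1) = (d * H) / 2"
        by simp_all
      ultimately show ?thesis
        using that by argo
    qed
    have cube_nonneg: "0 \<le> (1 - r ^ 3) * t ^ 3"
      using r t by (simp add: power_le_one)
    have "1 - r ^ 3 = (1 - r) * (1 + r + r ^ 2)"
      by (simp add: algebra_simps power2_eq_square power3_eq_cube)
    also have "\<dots> \<le> (1 - r) * 3"
      using r power_le_one[of r 2] by (intro mult_left_mono) auto
    finally have cube: "(1 - r ^ 3) * t ^ 3 \<le> (1 - r) * 3 * 1"
      using r t by (intro mult_mono power_le_one) auto
    show ?thesis
    proof (rule combine)
      show "\<bar>\<alpha> / 6 * ((1 - r ^ 3) * t ^ 3)\<bar> \<le> \<bar>\<alpha>\<bar> / 6 * ((1 - r) * 3)"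
        unfolding abs_mult[of "\<alpha> / 6"] using cube cube_nonneg by (intro mult_mono) auto
      show "\<bar>h / 2 * ((1 - r) * t)\<bar> \<le> \<bar>h\<bar> / 2 * ((1 - r) * 1)"
        unfolding abs_mult[of "h / 2"] using r(1,2) t
        by (intro mult_mono) (auto simp: abs_mult mult_left_le)
      show "\<bar>(1 - r) / 2 * entropy_fun t\<bar> \<le> (1 - r) / 2 * 1"
        unfolding abs_mult using r(1,2) entropy_fun_bounds[OF t] by (intro mult_mono) auto
    qed (use r(2) in auto)
  qed
  ultimately have "\<bar>edge_energy n \<alpha> h (real k) - real (n choose 2) * entropy_fun t
      - real n ^ 2 * scalar_functional \<alpha> h t\<bar>
      \<le> real n ^ 2 * ((1 - r) * (\<bar>\<alpha>\<bar> + \<bar>h\<bar> + 1))"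
    by (simp add: abs_mult mult_left_mono)
  also have "\<dots> = (\<bar>\<alpha>\<bar> + \<bar>h\<bar> + 1) * real n"
    using n r by (simp add: power2_eq_square)
  finally show ?thesis .
qed

text \<open>The partition function is at least its term at \<open>j\<close>, so the weight at \<open>k\<close> is controlled by
  a difference of scalar functionals. The errors of order \<open>n\<close> in the exponent are negligible
  against \<open>n\<^sup>2\<close>.\<close>

lemma edge_count_weight_le:
  assumes "2 \<le> n" "k \<le> n choose 2" "j \<le> n choose 2"
  shows "real ((n choose 2) choose k) * exp (edge_energy n \<alpha> h (real k)) / mf_partition n \<alpha> h
     \<le> (real (n choose 2) + 1) * exp (real n ^ 2 *
          (scalar_functional \<alpha> h (real k / real (n choose 2))
           - scalar_functional \<alpha> h (real j / real (n choose 2)))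
        + 2 * (\<bar>\<alpha>\<bar> + \<bar>h\<bar> + 1) * real n)"
proof -
  define N where "N = n choose 2"
  define C where "C = (\<bar>\<alpha>\<bar> + \<bar>h\<bar> + 1) * real n"
  let ?F = "\<lambda>i. real n ^ 2 * scalar_functional \<alpha> h (real i / real N)"
  let ?w = "\<lambda>i. real (N choose i) * exp (edge_energy n \<alpha> h (real i))"
  have N: "0 < N"
    using assms by (simp add: N_def zero_less_binomial)
  have split: "?w i = (real (N choose i) * exp (real N * entropy_fun (real i / real N)))
      * exp (edge_energy n \<alpha> h (real i) - real N * entropy_fun (real i / real N))" for i
    by (simp add: exp_diff)
  have "?w k \<le> 1 * exp (?F k + C)"
    unfolding split using assms choose_exp_entropy_bounds(1)[of k N] N
      energy_entropy_approx[OF assms(1,2), of \<alpha> h]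
    by (intro mult_mono) (auto simp: N_def C_def)
  then have upper: "?w k \<le> exp (?F k + C)"
    by simp
  have "1 * exp (?F j - C) \<le> ((real N + 1) * (real (N choose j)
      * exp (real N * entropy_fun (real j / real N))))
      * exp (edge_energy n \<alpha> h (real j) - real N * entropy_fun (real j / real N))"
    using assms choose_exp_entropy_bounds(2)[of j N] N
      energy_entropy_approx[OF assms(1,3), of \<alpha> h]
    by (intro mult_mono) (auto simp: N_def C_def)
  also have "\<dots> = (real N + 1) * ?w j"
    by (simp add: split[of j])
  also have "\<dots> \<le> (real N + 1) * mf_partition n \<alpha> h"
    using mf_partition_ge_term[OF assms(3), of \<alpha> h] by (intro mult_left_mono) (auto simp: N_def)
  finally have lower: "exp (?F j - C) \<le> (real N + 1) * mf_partition n \<alpha> h"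
    by simp
  have "?w k \<le> exp (?F k + C)"
    by (fact upper)
  also have "\<dots> = exp (?F j - C) * exp (?F k - ?F j + 2 * C)"
    by (simp flip: exp_add)
  also have "\<dots> \<le> (real N + 1) * mf_partition n \<alpha> h * exp (?F k - ?F j + 2 * C)"
    by (intro mult_right_mono lower) simp
  finally have "?w k / mf_partition n \<alpha> h \<le> (real N + 1) * exp (?F k - ?F j + 2 * C)"
    using mf_partition_pos[of n \<alpha> h] by (simp add: pos_divide_le_eq ac_simps)
  then show ?thesis
    by (simp add: N_def C_def right_diff_distrib ac_simps)
qed

lemma maximum_gap:
  assumes "maximizers \<alpha> h = {u}" "0 < \<epsilon>"
  obtains \<eta> where "0 < \<eta>"
    "\<And>t. 0 \<le> t \<Longrightarrow> t \<le> 1 \<Longrightarrow> \<epsilon> \<le> \<bar>t - u\<bar> \<Longrightarrow>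
       scalar_functional \<alpha> h t \<le> scalar_functional \<alpha> h u - \<eta>"
proof -
  define K where "K = {0..1} \<inter> {t. \<epsilon> \<le> \<bar>t - u\<bar>}"
  have "closed {t. \<epsilon> \<le> \<bar>t - u\<bar>}"
    by (intro closed_Collect_le continuous_intros)
  then have "compact K"
    unfolding K_def by (intro compact_Int_closed) auto
  show ?thesis
  proof (cases "K = {}")
    case True
    then show ?thesis
      by (intro that[of 1]) (auto simp: K_def disjoint_iff)
  next
    case False
    obtain s where s: "s \<in> K" "\<And>t. t \<in> K \<Longrightarrow> scalar_functional \<alpha> h t \<le> scalar_functional \<alpha> h s"
      using continuous_attains_sup[OF \<open>compact K\<close> False, of "scalar_functional \<alpha> h"]
        continuous_on_subset[OF continuous_on_scalar_functional, of K] by (auto simp: K_def)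
    have "s \<notin> maximizers \<alpha> h"
      using s assms by (auto simp: K_def)
    moreover have "u \<in> maximizers \<alpha> h"
      using assms by simp
    ultimately have "scalar_functional \<alpha> h s < scalar_functional \<alpha> h u"
      using s(1) by (force simp: maximizers_def K_def)
    with s(2) show ?thesis
      using that[of "scalar_functional \<alpha> h u - scalar_functional \<alpha> h s"] by (auto simp: K_def)
  qed
qed

text \<open>Densities at distance at least \<open>\<epsilon>\<close> from \<open>u\<close> lose \<open>2 \<eta>\<close> against the maximum, while rounding
  \<open>u\<close> down to a multiple of \<open>1 / (n choose 2)\<close> loses less than \<open>\<eta>\<close> for large \<open>n\<close>. Each of the
  fewer than \<open>n\<^sup>2\<close> values of the edge count thus has a weight of order \<open>n\<^sup>2 exp (- \<eta> n\<^sup>2 + O(n))\<close>.\<close>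

lemma edge_density_deviation_bound:
  assumes max: "maximizers \<alpha> h = {u}" and "0 < \<epsilon>"
  obtains \<eta> where "0 < \<eta>"
    "\<forall>\<^sub>F n in sequentially.
       measure (distr (mf_measure n \<alpha> h) borel (edge_count n))
         {y. \<epsilon> \<le> \<bar>y / real (n choose 2) - u\<bar>}
       \<le> real n ^ 4 * exp (- \<eta> * real n ^ 2 + 2 * (\<bar>\<alpha>\<bar> + \<bar>h\<bar> + 1) * real n)"
proof -
  let ?f = "scalar_functional \<alpha> h"
  have u: "0 < u" "u < 1"
    using maximizers_interior[of u \<alpha> h] max by auto
  obtain \<eta>2 where \<eta>2: "0 < \<eta>2"
    "\<And>t. 0 \<le> t \<Longrightarrow> t \<le> 1 \<Longrightarrow> \<epsilon> \<le> \<bar>t - u\<bar> \<Longrightarrow> ?f t \<le> ?f u - \<eta>2"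
    using maximum_gap[OF assms] by metis
  define \<eta> where "\<eta> = \<eta>2 / 2"
  define j where "j n = nat \<lfloor>u * real (n choose 2)\<rfloor>" for n
  have j: "j n \<le> n choose 2" for n
  proof -
    have "u * real (n choose 2) \<le> 1 * real (n choose 2)"
      using u by (intro mult_right_mono) auto
    then show ?thesis
      unfolding j_def by (simp add: nat_le_iff floor_le_iff)
  qed
  have "(\<lambda>n. real (j n) / real (n choose 2)) \<longlonglongrightarrow> u"
  proof (rule tendsto_sandwich)
    have big: "filterlim (\<lambda>n. real (n choose 2)) at_top sequentially"
      unfolding real_choose_2 by real_asymp
    then have pos: "\<forall>\<^sub>F n in sequentially. 0 < real (n choose 2)"
      by (simp add: filterlim_at_top_dense)
    have fl: "real (j n) = of_int \<lfloor>u * real (n choose 2)\<rfloor>" for n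
      using u by (simp add: j_def)
    show "\<forall>\<^sub>F n in sequentially. u - 1 / real (n choose 2) \<le> real (j n) / real (n choose 2)"
      using pos
    proof eventually_elim
      case (elim n)
      have "u * real (n choose 2) - 1 \<le> real (j n)"
        unfolding fl by linarith
      then have "(u * real (n choose 2) - 1) / real (n choose 2) \<le> real (j n) / real (n choose 2)"
        by (intro divide_right_mono) auto
      then show ?case
        using elim by (simp add: diff_divide_distrib)
    qed
    show "\<forall>\<^sub>F n in sequentially. real (j n) / real (n choose 2) \<le> u"
      using pos
    proof eventually_elim
      case (elim n)
      have "real (j n) \<le> u * real (n choose 2)"
        unfolding fl by linarith
      then show ?case
        using elim by (simp add: field_simps)
    qed
    show "(\<lambda>n. u - 1 / real (n choose 2)) \<longlonglongrightarrow> u"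
      unfolding real_choose_2 by real_asymp
  qed auto
  then have "(\<lambda>n. ?f (real (j n) / real (n choose 2))) \<longlonglongrightarrow> ?f u"
    using DERIV_isCont[OF scalar_functional_has_derivative[OF u]] isCont_tendsto_compose by metis
  then have near: "\<forall>\<^sub>F n in sequentially. ?f u - \<eta> < ?f (real (j n) / real (n choose 2))"
    using \<eta>2 by (intro order_tendstoD) (auto simp: \<eta>_def)
  show ?thesis
  proof (rule that)
    show "0 < \<eta>"
      using \<eta>2 by (simp add: \<eta>_def)
    show "\<forall>\<^sub>F n in sequentially.
       measure (distr (mf_measure n \<alpha> h) borel (edge_count n))
         {y. \<epsilon> \<le> \<bar>y / real (n choose 2) - u\<bar>}
       \<le> real n ^ 4 * exp (- \<eta> * real n ^ 2 + 2 * (\<bar>\<alpha>\<bar> + \<bar>h\<bar> + 1) * real n)"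
      using near eventually_ge_at_top[of 2]
    proof eventually_elim
      case (elim n)
      define N where "N = n choose 2"
      define E where "E = exp (- \<eta> * real n ^ 2 + 2 * (\<bar>\<alpha>\<bar> + \<bar>h\<bar> + 1) * real n)"
      let ?B = "{y. \<epsilon> \<le> \<bar>y / real N - u\<bar>}"
      have "closed ?B"
        by (intro closed_Collect_le continuous_intros) (use elim in \<open>auto simp: N_def zero_less_binomial\<close>)
      then have "measure (distr (mf_measure n \<alpha> h) borel (edge_count n)) ?B
          = (\<Sum>k | k \<le> N \<and> real k \<in> ?B.
              real (N choose k) * exp (edge_energy n \<alpha> h (real k)) / mf_partition n \<alpha> h)"
        unfolding N_def by (intro measure_edge_count) auto
      also have "\<dots> \<le> (\<Sum>k | k \<le> N \<and> real k \<in> ?B. (real N + 1) * E)"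
      proof (rule sum_mono)
        fix k
        assume "k \<in> {k. k \<le> N \<and> real k \<in> ?B}"
        then have k: "k \<le> N" "\<epsilon> \<le> \<bar>real k / real N - u\<bar>"
          by auto
        have "?f (real k / real N) \<le> ?f u - \<eta>2"
          using k by (intro \<eta>2) (auto simp: divide_le_eq_1)
        then have "?f (real k / real N) - ?f (real (j n) / real N) \<le> - \<eta>"
          using elim(1) by (simp add: \<eta>_def N_def)
        then have "real n ^ 2 * (?f (real k / real N) - ?f (real (j n) / real N)) \<le> real n ^ 2 * - \<eta>"
          by (intro mult_left_mono) auto
        then have "(real N + 1) * exp (real n ^ 2 *
            (?f (real k / real N) - ?f (real (j n) / real N)) + 2 * (\<bar>\<alpha>\<bar> + \<bar>h\<bar> + 1) * real n)
            \<le> (real N + 1) * E"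
          unfolding E_def by (intro mult_left_mono) (auto simp: mult.commute)
        then show "real (N choose k) * exp (edge_energy n \<alpha> h (real k)) / mf_partition n \<alpha> h
            \<le> (real N + 1) * E"
          using edge_count_weight_le[OF elim(2), of k "j n" \<alpha> h] k j[of n]
          unfolding N_def by linarith
      qed
      also have "\<dots> \<le> (real N + 1) * ((real N + 1) * E)"
      proof -
        have "card {k. k \<le> N \<and> real k \<in> ?B} \<le> card {..N}"
          by (intro card_mono) auto
        then have "real (card {k. k \<le> N \<and> real k \<in> ?B}) \<le> real N + 1"
          by simp
        then show ?thesis
          unfolding sum_constant by (intro mult_right_mono) (auto simp: E_def)
      qed
      also have "\<dots> \<le> real n ^ 2 * (real n ^ 2 * E)"
      proof -
        have "2 \<le> real n"
          using elim by simp
        then have "real n * 2 \<le> real n * real n"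
          by (intro mult_left_mono) auto
        moreover have "real N = (real n * real n - real n) / 2"
          by (simp add: N_def real_choose_2 right_diff_distrib)
        ultimately have "real N + 1 \<le> real n ^ 2"
          using \<open>2 \<le> real n\<close> unfolding power2_eq_square by argo
        then show ?thesis
          by (intro mult_mono) (auto simp: E_def)
      qed
      also have "\<dots> = real n ^ 4 * E"
        by (simp add: power2_eq_square power4_eq_xxxx)
      finally show ?case
        by (simp add: N_def E_def)
    qed
  qed
qed

lemma summable_gaussian_tail:
  fixes \<eta> C :: real
  assumes "0 < \<eta>"
  shows "summable (\<lambda>n. real n ^ 4 * exp (- \<eta> * real n ^ 2 + C * real n))"
proof (rule summable_comparison_test_ev)
  have "\<forall>\<^sub>F n in sequentially.
      real n ^ 4 * exp (- \<eta> * real n ^ 2 + C * real n) \<le> inverse (real n ^ 2)"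
    using assms by real_asymp
  then show "\<forall>\<^sub>F n in sequentially.
      norm (real n ^ 4 * exp (- \<eta> * real n ^ 2 + C * real n)) \<le> inverse (real n ^ 2)"
    by simp
  show "summable (\<lambda>n. inverse (real n ^ 2))"
    by (rule inverse_power_summable) simp
qed

text \<open>Borel--Cantelli along the thresholds \<open>1 / (m + 1)\<close>.\<close>

lemma (in prob_space) AE_tendsto_of_summable_tails:
  fixes X :: "nat \<Rightarrow> 'a \<Rightarrow> real"
  assumes [measurable]: "\<And>n. random_variable borel (X n)"
    and tails: "\<And>\<epsilon>. 0 < \<epsilon> \<Longrightarrow> summable (\<lambda>n. prob {\<omega> \<in> space M. \<epsilon> \<le> \<bar>X n \<omega> - c\<bar>})"
  shows "AE \<omega> in M. (\<lambda>n. X n \<omega>) \<longlonglongrightarrow> c"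
proof -
  have "AE \<omega> in M. \<forall>m. \<forall>\<^sub>F n in sequentially. \<bar>X n \<omega> - c\<bar> < 1 / real (Suc m)"
    unfolding AE_all_countable
  proof
    fix m
    have "AE \<omega> in M. \<forall>\<^sub>F n in sequentially.
        \<omega> \<in> space M - {\<omega> \<in> space M. 1 / real (Suc m) \<le> \<bar>X n \<omega> - c\<bar>}"
      by (rule borel_cantelli_AE1) (auto intro!: tails simp: emeasure_eq_measure)
    then show "AE \<omega> in M. \<forall>\<^sub>F n in sequentially. \<bar>X n \<omega> - c\<bar> < 1 / real (Suc m)"
      by eventually_elim (auto elim!: eventually_mono)
  qed
  then show ?thesis
  proof eventually_elim
    case (elim \<omega>)
    show ?case
    proof (rule tendstoI)
      fix \<epsilon> :: real
      assume "0 < \<epsilon>"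
      then obtain m where "1 / real (Suc m) < \<epsilon>"
        using nat_approx_posE by blast
      with elim[rule_format, of m] show "\<forall>\<^sub>F n in sequentially. dist (X n \<omega>) c < \<epsilon>"
        by (auto elim!: eventually_mono simp: dist_real_def)
    qed
  qed
qed

theorem theorem9p3:
  fixes \<alpha> h :: real and P :: "'w measure" and S :: "nat \<Rightarrow> 'w \<Rightarrow> real"
  assumes "(\<alpha>, h) \<in> U_rs"
    and "prob_space P"
    and "\<And>n. n \<ge> 1 \<Longrightarrow> S n \<in> borel_measurable P"
    and "\<And>n. n \<ge> 1 \<Longrightarrow> distr P borel (S n) = distr (mf_measure n \<alpha> h) borel (edge_count n)"
  shows "AE \<omega> in P. (\<lambda>n. 2 * S n \<omega> / real n ^ 2) \<longlonglongrightarrow> u_star \<alpha> h"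
proof -
  interpret prob_space P
    by fact
  define u where "u = u_star \<alpha> h"
  define X where "X n \<omega> = S (Suc n) \<omega> / real (Suc n choose 2)" for n \<omega>
  have S [measurable]: "S (Suc n) \<in> borel_measurable P" for n
    by (rule assms) simp
  have "AE \<omega> in P. (\<lambda>n. X n \<omega>) \<longlonglongrightarrow> u"
  proof (rule AE_tendsto_of_summable_tails)
    show "X n \<in> borel_measurable P" for n
      unfolding X_def by measurable
    fix \<epsilon> :: real
    assume "0 < \<epsilon>"
    define t where "t n = measure (distr (mf_measure n \<alpha> h) borel (edge_count n))
         {y. \<epsilon> \<le> \<bar>y / real (n choose 2) - u\<bar>}" for n
    have "maximizers \<alpha> h = {u}"
      unfolding u_def by (rule maximizers_eq_u_star) fact
    then obtain \<eta> where "0 < \<eta>"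
      and bound: "\<forall>\<^sub>F n in sequentially.
        t n \<le> real n ^ 4 * exp (- \<eta> * real n ^ 2 + 2 * (\<bar>\<alpha>\<bar> + \<bar>h\<bar> + 1) * real n)"
      unfolding t_def by (rule edge_density_deviation_bound[OF _ \<open>0 < \<epsilon>\<close>])
    have "summable t"
    proof (rule summable_comparison_test_ev[OF _ summable_gaussian_tail[OF \<open>0 < \<eta>\<close>]])
      show "\<forall>\<^sub>F n in sequentially.
        norm (t n) \<le> real n ^ 4 * exp (- \<eta> * real n ^ 2 + 2 * (\<bar>\<alpha>\<bar> + \<bar>h\<bar> + 1) * real n)"
        using bound by (simp add: t_def)
    qed
    then have "summable (\<lambda>n. t (Suc n))"
      by (simp add: summable_Suc_iff)
    moreover have "t (Suc n) = prob {\<omega> \<in> space P. \<epsilon> \<le> \<bar>X n \<omega> - u\<bar>}" for n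
    proof -
      have "{y. \<epsilon> \<le> \<bar>y / real (Suc n choose 2) - u\<bar>} \<in> sets borel"
        by measurable
      then have "measure (distr P borel (S (Suc n))) {y. \<epsilon> \<le> \<bar>y / real (Suc n choose 2) - u\<bar>}
          = prob (S (Suc n) -` {y. \<epsilon> \<le> \<bar>y / real (Suc n choose 2) - u\<bar>} \<inter> space P)"
        by (intro measure_distr S)
      then show ?thesis
        using assms(4)[of "Suc n"] by (simp add: t_def X_def vimage_def Int_def conj_commute)
    qed
    ultimately show "summable (\<lambda>n. prob {\<omega> \<in> space P. \<epsilon> \<le> \<bar>X n \<omega> - u\<bar>})"
      by simp
  qed
  then show ?thesis
  proof eventually_elim
    case (elim \<omega>)
    have "(\<lambda>n. S n \<omega> / real (n choose 2)) \<longlonglongrightarrow> u"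
      using elim unfolding X_def by (rule LIMSEQ_imp_Suc)
    moreover have "(\<lambda>n. 2 * real (n choose 2) / real n ^ 2) \<longlonglongrightarrow> 1"
      unfolding real_choose_2 by real_asymp
    ultimately have "(\<lambda>n. 2 * real (n choose 2) / real n ^ 2 * (S n \<omega> / real (n choose 2))) \<longlonglongrightarrow> 1 * u"
      by (intro tendsto_mult)
    moreover have "\<forall>\<^sub>F n in sequentially. 2 * real (n choose 2) / real n ^ 2
        * (S n \<omega> / real (n choose 2)) = 2 * S n \<omega> / real n ^ 2"
      using eventually_ge_at_top[of 2] by eventually_elim (auto simp: field_simps)
    ultimately show ?case
      unfolding u_def by (auto elim: Lim_transform_eventually)
  qed
qed

end
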